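(* Let $G$ be a critical net in $\mathbb{R}^k$ with finitely many leaves and contained in a bounded domain, and let $\{v_i\}_{i=1}^k$ be an orthonormal basis of $\mathbb{R}^k$. Then the total length $L$ of $G$ satisfies \[ L \le \frac{\big(\sum_{i=1}^k \ell_{v_i}^2\big)^{1/2}}{2}\,|\partial X| , \] where $\ell_{v_i}$ is the length of the projection of the graph with leaves removed onto the direction $v_i$. Furthermore, \[ \nu(X_{int}) \le 2|\partial X| + \Big(\sum_{i=1}^k D_{v_i}^2\Big)^{1/2}|\partial X| , \] where $D_{v_i}$ is the length (number of edges) of the longest path in the graph with leaves removed that uses only edges positively colinear with $v_i$, and $\nu(X_{int})=\sum_{x\in X_{int}}\nu(x)$.
   Context: Setting. $G$ is a graph with countable vertex set $X\subset\mathbb{R}^k$ (each vertex is identified with its position), all vertices having finite valency, embedded in $\mathbb{R}^k$ so that each edge $\{x,y\}$ is the straight segment from $x$ to $y$; $G$ is contained in a bounded set. $E$ is the set of (unordered) edges, $N(x)$ the set of neighbours of $x$, and $\nu(x)=|N(x)|$ the valency of $x$. A leaf is a vertex of valency $1$; the set of leaves is $\partial X$, and $X_{int}=X\setminus\partial X$ is the set of interior vertices, each of valency at least $3$ (there are no vertices of valency $2$). It is assumed that $\partial X$ is finite, $|\partial X|\ge 2$, and that no leaf is an accumulation point of $X$. $G$ is a critical net if for every continuous $d:\mathbb{R}^k\to\mathbb{R}^k$ with compact support containing no leaf, the sum $\sum_{\{x,y\}\in E}\frac{x-y}{\|x-y\|}\cdot\big(d(x)-d(y)\big)$ converges absolutely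 and equals $0$. Let $G'$ be the graph with leaves removed: its vertex set is $X_{int}$ and its edges are the edges of $G$ with both endpoints in $X_{int}$. The total length $L$ is the sum of the lengths of the edges of $G'$. For a unit vector $v$, $\ell_v=\sup_{x\in X_{int}} x\cdot v-\inf_{x\in X_{int}}x\cdot v$ ($0$ if $X_{int}=\emptyset$). An oriented edge $(x,y)$ is positively colinear with $v$ if $(y-x)\cdot v>0$. $D_v\in\mathbb{N}\cup\{\infty\}$ is the supremum of the $m$ for which there is a path $x_0,x_1,\dots,x_m$ in $G'$ with each $(x_{j-1},x_j)$ an edge of $G'$ satisfying $(x_j-x_{j-1})\cdot v>0$. *)

theory Defs
  imports "HOL-Analysis.Analysis"
begin

text \<open>A graph is given by its vertex set \<open>X\<close>, a set of points of \<open>\<real>\<^sup>k\<close>, and its edge set \<open>E\<close>, a set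
  of two-element subsets of \<open>X\<close>. The edge \<open>e\<close> is realised by the segment \<open>convex hull e\<close>.\<close>

definition neighbours :: "'a set set \<Rightarrow> 'a \<Rightarrow> 'a set" where
  "neighbours E x = {y. {x, y} \<in> E}"

definition valency :: "'a set set \<Rightarrow> 'a \<Rightarrow> nat" where
  "valency E x = card (neighbours E x)"

definition leaves :: "'a set \<Rightarrow> 'a set set \<Rightarrow> 'a set" where
  "leaves X E = {x \<in> X. valency E x = 1}"

definition interior_vertices :: "'a set \<Rightarrow> 'a set set \<Rightarrow> 'a set" where
  "interior_vertices X E = X - leaves X E"

definition interior_edges :: "'a set \<Rightarrow> 'a set set \<Rightarrow> 'a set set" where
  "interior_edges X E = {e \<in> E. e \<subseteq> interior_vertices X E}"

text \<open>The value on an unordered pair of a function that is symmetric in its two arguments; it is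
  meaningful only for such functions.\<close>

definition on_edge :: "('a \<Rightarrow> 'a \<Rightarrow> 'b) \<Rightarrow> 'a set \<Rightarrow> 'b" where
  "on_edge f e = (THE r. \<exists>x y. e = {x, y} \<and> r = f x y)"

lemma on_edge_eq:
  assumes "\<And>x y. f x y = f y x"
  shows "on_edge f {x, y} = f x y"
  unfolding on_edge_def
  by (rule the_equality) (use assms in \<open>auto simp: doubleton_eq_iff\<close>)

text \<open>In the last two assumptions, ``embedded'' is read as injectivity of the realisation: distinct
  edges meet at most in a common endpoint, and an edge contains no vertices besides its endpoints.
  The realisation need not be a homeomorphism onto its image, as interior vertices may accumulate.\<close>

locale embedded_graph =
  fixes X :: "'a::euclidean_space set" and E :: "'a set set"
  assumes countable_vertices: "countable X"
    and edges: "e \<in> E \<Longrightarrow> \<exists>x\<in>X. \<exists>y\<in>X. x \<noteq> y \<and> e = {x, y}"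
    and finite_valency: "x \<in> X \<Longrightarrow> finite (neighbours E x)"
    and edges_meet: "e \<in> E \<Longrightarrow> f \<in> E \<Longrightarrow> e \<noteq> f \<Longrightarrow> convex hull e \<inter> convex hull f = e \<inter> f"
    and edge_vertices: "e \<in> E \<Longrightarrow> convex hull e \<inter> X = e"

locale bounded_net = embedded_graph +
  assumes bounded_realisation: "bounded (X \<union> (\<Union>e\<in>E. convex hull e))"
    and interior_valency: "x \<in> interior_vertices X E \<Longrightarrow> valency E x \<ge> 3"
    and finite_leaves: "finite (leaves X E)"
    and two_leaves: "card (leaves X E) \<ge> 2"
    and leaf_not_accumulation: "x \<in> leaves X E \<Longrightarrow> \<not> x islimpt X"

definition support :: "('a::topological_space \<Rightarrow> 'b::zero) \<Rightarrow> 'a set" where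
  "support d = closure {x. d x \<noteq> 0}"

definition variation_term :: "('a::real_inner \<Rightarrow> 'a) \<Rightarrow> 'a set \<Rightarrow> real" where
  "variation_term d = on_edge (\<lambda>x y. ((x - y) /\<^sub>R norm (x - y)) \<bullet> (d x - d y))"

lemma variation_term_eq:
  "variation_term d {x, y} = ((x - y) /\<^sub>R norm (x - y)) \<bullet> (d x - d y)"
  unfolding variation_term_def
  by (rule on_edge_eq) (simp add: norm_minus_commute inner_diff_left inner_diff_right algebra_simps)

locale critical_net = bounded_net +
  assumes critical:
    "\<lbrakk>continuous_on UNIV d; compact (support d); support d \<inter> leaves X E = {}\<rbrakk> \<Longrightarrow>
      (\<lambda>e. norm (variation_term d e)) summable_on E \<and> (\<Sum>\<^sub>\<infinity>e\<in>E. variation_term d e) = 0"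

text \<open>Total length and total valency may a priori be infinite; sums in \<open>ennreal\<close> always exist.\<close>

definition total_length :: "'a::metric_space set \<Rightarrow> 'a set set \<Rightarrow> ennreal" where
  "total_length X E = (\<Sum>\<^sub>\<infinity>e\<in>interior_edges X E. ennreal (on_edge dist e))"

definition interior_valency_sum :: "'a set \<Rightarrow> 'a set set \<Rightarrow> ennreal" where
  "interior_valency_sum X E = (\<Sum>\<^sub>\<infinity>x\<in>interior_vertices X E. of_nat (valency E x))"

definition proj_length :: "'a::real_inner set \<Rightarrow> 'a set set \<Rightarrow> 'a \<Rightarrow> real" where
  "proj_length X E v =
    (if interior_vertices X E = {} then 0
     else (SUP x\<in>interior_vertices X E. x \<bullet> v) - (INF x\<in>interior_vertices X E. x \<bullet> v))"

definition positive_path ::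
    "'a::real_inner set \<Rightarrow> 'a set set \<Rightarrow> 'a \<Rightarrow> nat \<Rightarrow> (nat \<Rightarrow> 'a) \<Rightarrow> bool" where
  "positive_path X E v m p \<longleftrightarrow>
    (\<forall>j\<le>m. p j \<in> interior_vertices X E) \<and>
    (\<forall>j<m. {p j, p (Suc j)} \<in> interior_edges X E \<and> (p (Suc j) - p j) \<bullet> v > 0)"

definition path_depth :: "'a::real_inner set \<Rightarrow> 'a set set \<Rightarrow> 'a \<Rightarrow> enat" where
  "path_depth X E v = Sup {enat m | m. \<exists>p. positive_path X E v m p}"

definition ennreal_sqrt :: "ennreal \<Rightarrow> ennreal" where
  "ennreal_sqrt a = (if a = top then top else ennreal (sqrt (enn2real a)))"

definition orthonormal_basis :: "('i \<Rightarrow> 'a::real_inner) \<Rightarrow> bool" where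
  "orthonormal_basis v \<longleftrightarrow>
    (\<forall>i j. v i \<bullet> v j = (if i = j then 1 else 0)) \<and> span (range v) = UNIV"

end

theory Submission
  imports Defs
begin

text \<open>Absolute convergence for \<^emph>\<open>all\<close> continuous fields forces the net to be finite: otherwise there are
  infinitely many pairwise disjoint interior edges \<open>{x\<^sub>n, y\<^sub>n}\<close> with \<open>x\<^sub>n\<close> and \<open>y\<^sub>n\<close> convergent, and a continuous
  field taking at \<open>x\<^sub>n\<close> the value \<open>1 / n\<close> times the unit vector of the edge and vanishing at \<open>y\<^sub>n\<close> has a
  variation that dominates the harmonic series. In a finite net every function \<open>g\<close> on the interior
  vertices is an admissible field, so the variation of \<open>g\<close> over the interior edges is at most
  \<open>\<bar>\<partial>X\<bar> sup \<bar>g\<bar>\<close>. The choice \<open>g x = x - c\<close>, with \<open>c\<close> the centre of the bounding box, gives the length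
  bound. For the valencies let the \<open>i\<close>-th coordinate of \<open>g x\<close> be the length of the longest
  \<open>v\<^sub>i\<close>-positive path ending in \<open>x\<close>, shifted by \<open>D\<^sub>i / 2\<close>; then each interior edge contributes at least 1.\<close>

subsection \<open>Continuous fields with prescribed values on two sequences\<close>

text \<open>Continuity is trivial at an isolated point of \<open>S\<close>. A limit point is not a
  limit point of any of the finite sets of large values, so \<open>f\<close> tends to 0 there, which
  is its value.\<close>

lemma continuous_on_if_large_values_finite:
  fixes f :: "'a::metric_space \<Rightarrow> 'b::real_normed_vector"
  assumes large: "\<And>r. r > 0 \<Longrightarrow> finite {z \<in> S. r \<le> norm (f z)}"
    and zero: "\<And>z. z \<in> S \<Longrightarrow> z islimpt S \<Longrightarrow> f z = 0"
  shows "continuous_on S f"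
  unfolding continuous_on_def
proof
  fix z assume "z \<in> S"
  show "(f \<longlongrightarrow> f z) (at z within S)"
  proof (cases "z islimpt S")
    case False
    then show ?thesis
      by (simp add: trivial_limit_within[symmetric] trivial_limit_def[symmetric])
  next
    case True
    have "\<forall>\<^sub>F w in at z within S. norm (f w) < r" if "r > 0" for r
    proof -
      have "\<not> z islimpt {w \<in> S. r \<le> norm (f w)}"
        using large[OF that] islimpt_finite by blast
      then have "\<forall>\<^sub>F w in at z. w \<notin> {w \<in> S. r \<le> norm (f w)}"
        by (simp add: islimpt_iff_eventually)
      then show ?thesis
        unfolding eventually_at_filter by eventually_elim auto
    qed
    then show ?thesis
      using zero[OF \<open>z \<in> S\<close> True] by (simp add: tendsto_iff)
  qed
qed

text \<open>The two sequences together with their limits form a closed set whose only possible limit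
  points are \<open>a\<close> and \<open>b\<close>. The prescribed values tend to 0 and
  \<open>f\<close> vanishes at \<open>a\<close> and \<open>b\<close>, so \<open>f\<close> is
  continuous on this set and extends by the Dugundji (Tietze) theorem.\<close>

lemma continuous_interpolation:
  fixes x y :: "nat \<Rightarrow> 'a::euclidean_space" and c :: "nat \<Rightarrow> 'b::real_inner"
  assumes "inj x" and xa: "x \<longlonglongrightarrow> a" and yb: "y \<longlonglongrightarrow> b" and c0: "c \<longlonglongrightarrow> 0"
    and disj: "range x \<inter> range y = {}" "a \<notin> range x" "b \<notin> range x"
  obtains g where "continuous_on UNIV g" "\<And>n. g (x n) = c n" "\<And>n. g (y n) = 0"
proof -
  define S where "S = insert a (insert b (range x \<union> range y))"
  define f where "f z = (if z \<in> range x then c (inv x z) else 0)" for z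
  have fx: "f (x n) = c n" and fy: "f (y n) = 0" for n
    using \<open>inj x\<close> disj by (auto simp: f_def)
  have limpt: "z = a \<or> z = b" if "z islimpt S" for z
    using that sequence_unique_limpt[OF xa] sequence_unique_limpt[OF yb]
    by (auto simp: S_def islimpt_insert islimpt_Un)
  have "continuous_on S f"
  proof (rule continuous_on_if_large_values_finite)
    fix r :: real assume "r > 0"
    then have "\<forall>\<^sub>F n in sequentially. norm (c n) < r"
      using c0 by (simp add: tendsto_iff)
    then have "finite {n. r \<le> norm (c n)}"
      by (simp add: cofinite_eq_sequentially[symmetric] eventually_cofinite not_less)
    moreover have "{z \<in> S. r \<le> norm (f z)} \<subseteq> x ` {n. r \<le> norm (c n)}"
      using \<open>r > 0\<close> \<open>inj x\<close> by (auto simp: f_def split: if_splits)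
    ultimately show "finite {z \<in> S. r \<le> norm (f z)}"
      using finite_surj by blast
  next
    fix z assume "z islimpt S"
    then show "f z = 0"
      using limpt disj by (auto simp: f_def)
  qed
  moreover have "closed S"
    unfolding closed_limpt using limpt by (auto simp: S_def)
  ultimately obtain g where "continuous_on UNIV g" "\<And>z. z \<in> S \<Longrightarrow> g z = f z"
    using Dugundji[of "UNIV :: 'b set" UNIV S f] by auto
  then show thesis
    using that[of g] fx fy by (simp add: S_def)
qed

text \<open>Greedy choice: the finitely many members chosen so far meet only finitely many members
  of \<open>F\<close>, so one disjoint from all of them remains.\<close>

lemma infinite_disjoint_sequence:
  assumes "infinite F" and meet: "\<And>e. e \<in> F \<Longrightarrow> finite {f \<in> F. e \<inter> f \<noteq> {}}"
  obtains e :: "nat \<Rightarrow> 'a set" where "range e \<subseteq> F" "\<And>m n. m \<noteq> n \<Longrightarrow> e m \<inter> e n = {}"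
proof -
  have "\<exists>e :: nat \<Rightarrow> 'a set. \<forall>n. e n \<in> F \<and> (\<forall>m<n. e m \<inter> e n = {})"
  proof (rule dependent_wellorder_choice)
    fix n :: nat and e :: "nat \<Rightarrow> 'a set"
    assume "\<And>m. m < n \<Longrightarrow> e m \<in> F \<and> (\<forall>l<m. e l \<inter> e m = {})"
    then have "finite (\<Union>m<n. {f \<in> F. e m \<inter> f \<noteq> {}})"
      using meet by simp
    with \<open>infinite F\<close> obtain r where "r \<in> F" "r \<notin> (\<Union>m<n. {f \<in> F. e m \<inter> f \<noteq> {}})"
      by (meson finite_subset subsetI)
    then show "\<exists>r. r \<in> F \<and> (\<forall>m<n. e m \<inter> r = {})"
      by blast
  qed simp
  then obtain e :: "nat \<Rightarrow> 'a set" where e: "\<And>n. e n \<in> F" "\<And>m n. m < n \<Longrightarrow> e m \<inter> e n = {}"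
    by blast
  then have "e m \<inter> e n = {}" if "m \<noteq> n" for m n
    using that by (metis Int_commute nat_neq_iff)
  with e show thesis
    using that by blast
qed

subsection \<open>Edges, leaves and heights\<close>

context embedded_graph
begin

lemma edgeE:
  assumes "e \<in> E"
  obtains x y where "x \<in> X" "y \<in> X" "x \<noteq> y" "e = {x, y}"
  using edges[OF assms] by blast

lemma incident_edges_eq: "{e \<in> E. x \<in> e} = (\<lambda>y. {x, y}) ` neighbours E x"
proof (intro equalityI subsetI)
  fix e assume "e \<in> {e \<in> E. x \<in> e}"
  then have "e \<in> E" "x \<in> e" by auto
  then obtain y where "e = {x, y}"
    by (metis edgeE insertE insert_commute singletonD)
  with \<open>e \<in> E\<close> show "e \<in> (\<lambda>y. {x, y}) ` neighbours E x"
    by (auto simp: neighbours_def)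
qed (auto simp: neighbours_def)

lemma finite_incident_edges: "finite {e \<in> E. x \<in> e}"
proof (cases "x \<in> X")
  case True
  then show ?thesis
    unfolding incident_edges_eq by (simp add: finite_valency)
next
  case False
  then have "{e \<in> E. x \<in> e} = {}"
    by (auto elim: edgeE)
  then show ?thesis
    by (simp only: finite.emptyI)
qed

lemma valency_eq_card_incident: "valency E x = card {e \<in> E. x \<in> e}"
proof -
  have "inj_on (\<lambda>y. {x, y}) (neighbours E x)"
    by (auto simp: inj_on_def doubleton_eq_iff)
  then show ?thesis
    by (simp add: incident_edges_eq valency_def card_image)
qed

lemma interior_edges_subset: "interior_edges X E \<subseteq> E"
  by (auto simp: interior_edges_def)

lemma interior_edge_vertices:
  assumes "{x, y} \<in> interior_edges X E"
  shows "x \<in> interior_vertices X E" "y \<in> interior_vertices X E" "x \<noteq> y"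
  using assms by (auto simp: interior_edges_def doubleton_eq_iff elim!: edgeE)

lemma interior_edgeE:
  assumes "e \<in> interior_edges X E"
  obtains x y where "e = {x, y}" "x \<in> interior_vertices X E" "y \<in> interior_vertices X E" "x \<noteq> y"
  using assms by (metis edgeE interior_edges_subset interior_edge_vertices subsetD)

lemma leaf_edge_contains_leaf:
  assumes "e \<in> E - interior_edges X E"
  obtains x where "x \<in> leaves X E" "x \<in> e"
  using assms by (auto simp: interior_edges_def interior_vertices_def elim!: edgeE)

text \<open>An edge that is not interior contains a leaf, and a leaf lies on exactly one edge, so
  sending a leaf to its edge reaches every such edge. This yields both finiteness and the bound by
  the number of leaves; an edge joining two leaves is reached twice.\<close>

lemma leaf_edges_subset:
  "E - interior_edges X E \<subseteq> (\<lambda>x. THE e. e \<in> E \<and> x \<in> e) ` leaves X E"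
proof
  fix e assume e: "e \<in> E - interior_edges X E"
  then obtain x where x: "x \<in> leaves X E" "x \<in> e"
    by (rule leaf_edge_contains_leaf)
  then have "card {e \<in> E. x \<in> e} = 1"
    by (simp add: leaves_def valency_eq_card_incident)
  then obtain e' where "{e \<in> E. x \<in> e} = {e'}"
    by (rule card_1_singletonE)
  then have e': "f \<in> E \<and> x \<in> f \<longleftrightarrow> f = e'" for f
    by (simp add: set_eq_iff)
  moreover have "e' = e"
    using e x e'[of e] by simp
  ultimately have "(THE e. e \<in> E \<and> x \<in> e) = e"
    by simp
  with x show "e \<in> (\<lambda>x. THE e. e \<in> E \<and> x \<in> e) ` leaves X E"
    by force
qed

text \<open>An integer-valued substitute for the coordinate \<open>x \<bullet> w\<close>. The
  \<open>Max\<close> is meaningful when the depth in direction \<open>w\<close> is finite and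
  \<open>x\<close> is an interior vertex: the set is then bounded, and the path of length 0 makes it
  nonempty.\<close>

definition height :: "'a \<Rightarrow> 'a \<Rightarrow> nat" where
  "height w x = Max {m. \<exists>p. positive_path X E w m p \<and> p m = x}"

lemma positive_path_le_depth:
  assumes "path_depth X E w = enat D" "positive_path X E w m p"
  shows "m \<le> D"
proof -
  have "enat m \<le> path_depth X E w"
    unfolding path_depth_def using assms(2) by (intro Sup_upper) blast
  then show ?thesis
    using assms(1) by simp
qed

lemma height_attained:
  assumes "path_depth X E w = enat D" "x \<in> interior_vertices X E"
  obtains p where "positive_path X E w (height w x) p" "p (height w x) = x"
proof -
  let ?H = "{m. \<exists>p. positive_path X E w m p \<and> p m = x}"
  have "?H \<subseteq> {..D}"
    using positive_path_le_depth[OF assms(1)] by auto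
  then have "finite ?H"
    using finite_subset by blast
  moreover have "0 \<in> ?H"
    using assms(2) by (auto simp: positive_path_def)
  ultimately have "height w x \<in> ?H"
    unfolding height_def by (intro Max_in) auto
  then show thesis
    using that by blast
qed

lemma height_le_depth:
  assumes "path_depth X E w = enat D" "x \<in> interior_vertices X E"
  shows "height w x \<le> D"
  using assms height_attained positive_path_le_depth by metis

text \<open>Appending \<open>y\<close> to a longest positive path ending in \<open>x\<close> gives a
  positive path ending in \<open>y\<close> with one more edge.\<close>

lemma height_increases:
  assumes D: "path_depth X E w = enat D" and xy: "{x, y} \<in> interior_edges X E"
    and pos: "(y - x) \<bullet> w > 0"
  shows "height w x < height w y"
proof -
  let ?H = "{m. \<exists>p. positive_path X E w m p \<and> p m = y}"
  let ?m = "height w x"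
  obtain p where p: "positive_path X E w ?m p" "p ?m = x"
    using height_attained[OF D interior_edge_vertices(1)[OF xy]] .
  let ?p = "\<lambda>j. if j \<le> ?m then p j else y"
  have "positive_path X E w (Suc ?m) ?p"
    using p xy pos interior_edge_vertices(2)[OF xy]
    by (auto simp: positive_path_def less_Suc_eq le_Suc_eq)
  then have "Suc ?m \<in> ?H"
    by (auto intro!: exI[of _ ?p])
  moreover have "?H \<subseteq> {..D}"
    using positive_path_le_depth[OF D] by auto
  then have "finite ?H"
    using finite_subset by blast
  ultimately have "Suc ?m \<le> height w y"
    unfolding height_def by (rule Max_ge[rotated])
  then show ?thesis
    by simp
qed

text \<open>The proof uses \<open>\<bar>u \<bullet> w\<bar> \<ge> (u \<bullet> w)\<^sup>2\<close>; the squares are chosen because their sum over an orthonormal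
  basis is 1.\<close>

lemma height_variation_ge:
  assumes D: "path_depth X E w = enat D" and xy: "{x, y} \<in> interior_edges X E"
    and "norm w = 1"
  defines "u \<equiv> (x - y) /\<^sub>R norm (x - y)"
  shows "(u \<bullet> w)\<^sup>2 \<le> (u \<bullet> w) * (real (height w x) - real (height w y))"
proof -
  have nz: "norm (x - y) > 0"
    using interior_edge_vertices(3)[OF xy] by simp
  then have "norm u = 1"
    by (simp add: u_def)
  then have le1: "\<bar>u \<bullet> w\<bar> \<le> 1"
    using Cauchy_Schwarz_ineq2[of u w] \<open>norm w = 1\<close> by simp
  have sgn: "u \<bullet> w = ((x - y) \<bullet> w) / norm (x - y)"
    by (simp add: u_def divide_inverse_commute)
  consider "u \<bullet> w = 0" | "u \<bullet> w > 0" | "u \<bullet> w < 0"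
    by linarith
  then show ?thesis
  proof cases
    case 2
    then have "(x - y) \<bullet> w > 0"
      using nz by (simp add: sgn zero_less_divide_iff)
    then have "height w y < height w x"
      using height_increases[OF D, of y x] xy by (simp add: insert_commute)
    \<comment> \<open>Heights are integers, so the difference is at least 1, hence at least
      \<open>\<bar>u \<bullet> w\<bar>\<close>. The third case is the mirror image.\<close>
    then show ?thesis
      unfolding power2_eq_square using 2 le1 by (intro mult_left_mono) auto
  next
    case 3
    then have "(y - x) \<bullet> w > 0"
      using nz by (simp add: sgn divide_less_0_iff inner_diff_left)
    then have "height w x < height w y"
      using height_increases[OF D xy] by simp
    then show ?thesis
      unfolding power2_eq_square using 3 le1 by (intro mult_left_mono_neg) auto
  qed simp
qed

end

section \<open>Leaf edges, and separation of the leaves from the interior vertices\<close>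

context bounded_net
begin

lemma finite_leaf_edges: "finite (E - interior_edges X E)"
  using leaf_edges_subset finite_leaves finite_surj by blast

lemma card_leaf_edges_le: "card (E - interior_edges X E) \<le> card (leaves X E)"
  using surj_card_le[OF finite_leaves leaf_edges_subset] .

lemma bounded_interior_vertices: "bounded (interior_vertices X E)"
  using bounded_realisation by (rule bounded_subset) (auto simp: interior_vertices_def)

lemma compact_closure_interior_vertices: "compact (closure (interior_vertices X E))"
  using bounded_interior_vertices by simp

lemma closure_interior_vertices_disjoint:
  "closure (interior_vertices X E) \<inter> leaves X E = {}"
proof -
  have "\<not> b islimpt interior_vertices X E" if "b \<in> leaves X E" for b
    using leaf_not_accumulation[OF that] islimpt_subset[of b "interior_vertices X E" X]
    by (auto simp: interior_vertices_def)
  then show ?thesis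
    by (auto simp: closure_def interior_vertices_def)
qed

lemma edge_of_vertex:
  assumes "x \<in> interior_vertices X E"
  obtains e where "e \<in> E" "x \<in> e"
proof -
  have "card {e \<in> E. x \<in> e} \<noteq> 0"
    using interior_valency[OF assms] by (simp add: valency_eq_card_incident)
  then show thesis
    using that by (metis (no_types, lifting) card.empty empty_Collect_eq)
qed

text \<open>The closure \<open>K\<close> of the interior vertices is compact and has positive
  distance to each of the finitely many leaves, so a tent function of the distance to
  \<open>K\<close> serves as cutoff.\<close>

lemma leaf_cutoff:
  obtains \<phi> :: "'a \<Rightarrow> real" where "continuous_on UNIV \<phi>" "compact (support \<phi>)"
    "support \<phi> \<inter> leaves X E = {}" "\<And>x. x \<in> interior_vertices X E \<Longrightarrow> \<phi> x = 1"
\<comment> \<open>\<open>infdist\<close> to the empty set is 0 by convention, so this case is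
  separated and the zero function is taken.\<close>
proof (cases "interior_vertices X E = {}")
  case True
  then show thesis
    using that[of "\<lambda>_. 0"] by (simp add: support_def)
next
  case False
  define K where "K = closure (interior_vertices X E)"
  have K: "compact K" "K \<noteq> {}" "K \<inter> leaves X E = {}"
    unfolding K_def using False compact_closure_interior_vertices
      closure_interior_vertices_disjoint by auto
  have pos: "0 < infdist b K" if "b \<in> leaves X E" for b
    using K that by (intro infdist_pos_not_in_closed) (auto intro: compact_imp_closed)
  \<comment> \<open>Half the least distance from a leaf to \<open>K\<close>, so that even the closed
    \<open>r\<close>-neighbourhood of \<open>K\<close> contains no leaf.\<close>
  define r where "r = Min ((\<lambda>b. infdist b K) ` leaves X E) / 2"
  have ne: "leaves X E \<noteq> {}"
    using two_leaves by auto
  then have "r > 0"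
    using pos finite_leaves by (simp add: r_def)
  have r: "r < infdist b K" if "b \<in> leaves X E" for b
  proof -
    have "2 * r \<le> infdist b K"
      using that finite_leaves by (simp add: r_def)
    with pos[OF that] \<open>r > 0\<close> show ?thesis by simp
  qed
  define \<phi> where "\<phi> x = max 0 (1 - infdist x K / r)" for x
  have "{x. \<phi> x \<noteq> 0} \<subseteq> {x. infdist x K \<le> r}"
    using \<open>r > 0\<close> by (auto simp: \<phi>_def max_def field_simps)
  moreover have "compact {x. infdist x K \<le> r}"
    using compact_infdist_le[OF K(2,1) \<open>r > 0\<close>] .
  ultimately have *: "support \<phi> \<subseteq> {x. infdist x K \<le> r}"
    unfolding support_def by (simp add: closure_minimal compact_imp_closed)
  show thesis
  proof (rule that[of \<phi>])
    show "continuous_on UNIV \<phi>"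
      unfolding \<phi>_def using \<open>r > 0\<close> by (intro continuous_intros) auto
    show "compact (support \<phi>)"
      using * \<open>compact {x. infdist x K \<le> r}\<close>
      by (metis support_def compact_closure closure_closure compact_imp_bounded bounded_subset)
    show "support \<phi> \<inter> leaves X E = {}"
      using * r by force
    show "\<phi> x = 1" if "x \<in> interior_vertices X E" for x
      using that closure_subset[of "interior_vertices X E"] by (auto simp: \<phi>_def K_def)
  qed
qed

end

subsection \<open>Finiteness of critical nets\<close>

context critical_net
begin

text \<open>Variation terms only see values at vertices. The product of \<open>g\<close> with the
  leaf cutoff is an admissible field that agrees with \<open>d\<close> at every vertex, so
  criticality carries over to \<open>d\<close>, although \<open>d\<close> itself may be
  discontinuous.\<close>

lemma critical_cutoff:
  fixes g :: "'a \<Rightarrow> 'a"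
  assumes g: "continuous_on UNIV g"
  defines "d \<equiv> \<lambda>x. if x \<in> leaves X E then 0 else g x"
  shows "(\<lambda>e. norm (variation_term d e)) summable_on E"
    and "(\<Sum>\<^sub>\<infinity>e\<in>E. variation_term d e) = 0"
proof -
  obtain \<phi> :: "'a \<Rightarrow> real" where \<phi>: "continuous_on UNIV \<phi>" "compact (support \<phi>)"
    "support \<phi> \<inter> leaves X E = {}" "\<And>x. x \<in> interior_vertices X E \<Longrightarrow> \<phi> x = 1"
    by (rule leaf_cutoff) blast
  let ?h = "\<lambda>x. \<phi> x *\<^sub>R g x"
  have sub: "support ?h \<subseteq> support \<phi>"
    unfolding support_def by (intro closure_mono) auto
  have "compact (support ?h)"
    using compact_Int_closed[OF \<phi>(2), of "support ?h"] sub
    by (simp add: Int_absorb1 support_def)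
  then have *: "(\<lambda>e. norm (variation_term ?h e)) summable_on E \<and>
      (\<Sum>\<^sub>\<infinity>e\<in>E. variation_term ?h e) = 0"
    using sub \<phi> g by (intro critical continuous_intros) auto
  have hd: "?h x = d x" if "x \<in> X" for x
  proof (cases "x \<in> leaves X E")
    case True
    then have "\<phi> x = 0"
      using \<phi>(3) closure_subset[of "{x. \<phi> x \<noteq> 0}"] by (auto simp: support_def)
    with True show ?thesis
      by (simp add: d_def)
  next
    case False
    with that \<phi>(4)[of x] show ?thesis
      by (simp add: d_def interior_vertices_def)
  qed
  have eq: "variation_term ?h e = variation_term d e" if "e \<in> E" for e
    using that hd by (auto elim!: edgeE simp: variation_term_eq)
  from * show "(\<lambda>e. norm (variation_term d e)) summable_on E"
    by (simp add: eq cong: summable_on_cong)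
  from * show "(\<Sum>\<^sub>\<infinity>e\<in>E. variation_term d e) = 0"
    by (simp add: eq cong: infsum_cong)
qed

theorem finite_edges: "finite E"
proof (rule ccontr)
  assume "infinite E"
  then have inf: "infinite (interior_edges X E)"
    using finite_leaf_edges finite_Diff2 by blast
  note IE = interior_edges_subset
  \<comment> \<open>Finite valency at both endpoints gives the local finiteness that the greedy
    choice of disjoint edges requires.\<close>
  have "finite {f \<in> interior_edges X E. e \<inter> f \<noteq> {}}" if "e \<in> interior_edges X E" for e
  proof (rule finite_subset)
    show "{f \<in> interior_edges X E. e \<inter> f \<noteq> {}} \<subseteq> (\<Union>x\<in>e. {f \<in> E. x \<in> f})"
      using IE by auto
    show "finite (\<Union>x\<in>e. {f \<in> E. x \<in> f})"
      using that IE finite_incident_edges by (auto elim!: edgeE)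
  qed
  then obtain e :: "nat \<Rightarrow> 'a set" where e: "range e \<subseteq> interior_edges X E" "\<And>m n. m \<noteq> n \<Longrightarrow> e m \<inter> e n = {}"
    using infinite_disjoint_sequence[OF inf] by blast
  have "\<exists>x y. x \<noteq> y \<and> e n = {x, y}" for n
    using e(1) IE by (metis edgeE range_subsetD subsetD)
  then obtain x y where xy: "\<And>n. x n \<noteq> y n" "\<And>n. e n = {x n, y n}"
    by metis
  have V: "x n \<in> interior_vertices X E" "y n \<in> interior_vertices X E" for n
    using e(1) xy(2)[of n] by (auto simp: interior_edges_def)
  \<comment> \<open>Compactness of the product yields one subsequence along which both endpoints
    converge.\<close>
  have seq: "seq_compact (closure (interior_vertices X E) \<times> closure (interior_vertices X E))"
    by (intro compact_imp_seq_compact compact_Times compact_closure_interior_vertices)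
  have "\<forall>n. (x n, y n) \<in> closure (interior_vertices X E) \<times> closure (interior_vertices X E)"
    using V closure_subset by fastforce
  then obtain p s where s: "strict_mono s" and lim: "((\<lambda>n. (x n, y n)) \<circ> s) \<longlonglongrightarrow> p"
    using seq_compactE[OF seq, of "\<lambda>n. (x n, y n)"] by blast
  obtain a b where "p = (a, b)"
    by fastforce
  \<comment> \<open>The limits \<open>a\<close> and \<open>b\<close> may be endpoints of chosen
    edges, but the interpolating field vanishes at both limits. By disjointness each point lies on
    at most one \<open>e n\<close>, so dropping the first terms of the sequence avoids them.\<close>
  have "finite {n. c \<in> e n}" for c
  proof -
    have "{n. c \<in> e n} \<subseteq> {m}" if "c \<in> e m" for m
      using that e(2) by (auto simp: disjoint_iff)
    then show ?thesis
      by (metis (mono_tags, lifting) Collect_empty_eq finite.emptyI finite_insert finite_subset)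
  qed
  then have "finite ({n. a \<in> e n} \<union> {n. b \<in> e n})"
    by simp
  then obtain N where N: "\<And>n. n \<ge> N \<Longrightarrow> a \<notin> e n \<and> b \<notin> e n"
    unfolding finite_nat_set_iff_bounded by (auto simp: not_less[symmetric])
  define t where "t n = s (n + N)" for n
  have "t n \<ge> N" for n
    using seq_suble[OF s, of "n + N"] by (simp add: t_def)
  then have ab: "a \<notin> e (t n)" "b \<notin> e (t n)" for n
    using N by auto
  have "inj t"
    by (simp add: t_def inj_def strict_mono_eq[OF s])
  have "inj e"
    using e(2) xy(2) by (metis Int_absorb injI insert_not_empty)
  have et: "e (t m) \<inter> e (t n) = {}" if "m \<noteq> n" for m n
    using e(2) \<open>inj t\<close> that by (metis injD)
  have lim': "(\<lambda>n. x (s n)) \<longlonglongrightarrow> a" "(\<lambda>n. y (s n)) \<longlonglongrightarrow> b"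
    using tendsto_fst[OF lim] tendsto_snd[OF lim] by (simp_all add: \<open>p = (a, b)\<close> o_def)
  define u where "u n = (x n - y n) /\<^sub>R norm (x n - y n)" for n
  have nu: "norm (u n) = 1" for n
    using xy(1) by (simp add: u_def)
  \<comment> \<open>The factors tend to 0, as continuity at the limit requires, while their sum
    diverges. For \<open>n = 0\<close> the factor is 0 by the convention for \<open>inverse\<close>,
    which is harmless.\<close>
  have "(\<lambda>n. inverse (real n) *\<^sub>R u (t n)) \<longlonglongrightarrow> 0"
    by (rule tendsto_norm_zero_cancel) (simp add: nu lim_inverse_n)
  moreover have "inj (\<lambda>n. x (t n))"
    using et xy(2) by (fastforce intro: injI)
  moreover have "(\<lambda>n. x (t n)) \<longlonglongrightarrow> a" "(\<lambda>n. y (t n)) \<longlonglongrightarrow> b"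
    unfolding t_def using lim' by (auto intro: LIMSEQ_ignore_initial_segment)
  moreover have "x (t m) \<noteq> y (t n)" for m n
    using et[of m n] xy by (cases "m = n") auto
  ultimately obtain g where g: "continuous_on UNIV g"
    "\<And>n. g (x (t n)) = inverse (real n) *\<^sub>R u (t n)" "\<And>n. g (y (t n)) = 0"
    using ab xy(2)
      continuous_interpolation[of "\<lambda>n. x (t n)" a "\<lambda>n. y (t n)" b "\<lambda>n. inverse (real n) *\<^sub>R u (t n)"]
    by (smt (verit, ccfv_threshold) disjoint_iff imageE insertCI)
  define d where "d = (\<lambda>z. if z \<in> leaves X E then 0 else g z)"
  have "(\<lambda>e. norm (variation_term d e)) summable_on E"
    unfolding d_def by (rule critical_cutoff(1)[OF g(1)])
  moreover have "range (\<lambda>n. e (t n)) \<subseteq> E"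
    using e(1) IE by blast
  ultimately have "(\<lambda>e. norm (variation_term d e)) summable_on range (\<lambda>n. e (t n))"
    by (rule summable_on_subset_banach)
  moreover have "inj (\<lambda>n. e (t n))"
    using \<open>inj e\<close> \<open>inj t\<close> by (simp add: inj_def)
  ultimately have "(\<lambda>n. norm (variation_term d (e (t n)))) summable_on UNIV"
    by (simp add: summable_on_reindex o_def)
  \<comment> \<open>The endpoints are interior, so \<open>d\<close> agrees with \<open>g\<close>
    there, and the pairing of the edge's unit vector with itself is 1.\<close>
  moreover have "norm (variation_term d (e (t n))) = inverse (real n)" for n
  proof -
    have "d (x (t n)) = inverse (real n) *\<^sub>R u (t n)" "d (y (t n)) = 0"
      using V g by (auto simp: d_def interior_vertices_def)
    then have "variation_term d (e (t n)) = inverse (real n) * (u (t n) \<bullet> u (t n))"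
      by (simp add: xy(2) variation_term_eq u_def)
    then show ?thesis
      by (simp add: dot_square_norm nu)
  qed
  ultimately have "summable (\<lambda>n. inverse (real n))"
    using summable_on_imp_summable by simp
  then show False
    using not_summable_harmonic by blast
qed

end

subsection \<open>Length and valency bounds\<close>

lemma orthonormal_expand:
  fixes v :: "'i::finite \<Rightarrow> 'a::euclidean_space"
  assumes "orthonormal_basis v"
  shows "(\<Sum>i\<in>UNIV. (x \<bullet> v i) *\<^sub>R v i) = x"
proof -
  have v: "v i \<bullet> v j = (if i = j then 1 else 0)" for i j
    using assms by (simp add: orthonormal_basis_def)
  then have "inj v"
    by (metis injI zero_neq_one)
  have "(\<Sum>b\<in>range v. (x \<bullet> b) *\<^sub>R b) = x"
    using assms v by (intro orthonormal_basis_expand)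
      (auto simp: pairwise_def orthogonal_def norm_eq_sqrt_inner orthonormal_basis_def)
  then show ?thesis
    by (simp add: sum.reindex[OF \<open>inj v\<close>])
qed

lemma orthonormal_inner:
  fixes v :: "'i::finite \<Rightarrow> 'a::euclidean_space"
  assumes "orthonormal_basis v"
  shows "x \<bullet> y = (\<Sum>i\<in>UNIV. (x \<bullet> v i) * (y \<bullet> v i))"
proof -
  have "x \<bullet> y = x \<bullet> (\<Sum>i\<in>UNIV. (y \<bullet> v i) *\<^sub>R v i)"
    by (simp add: orthonormal_expand[OF assms])
  then show ?thesis
    by (simp add: inner_sum_right mult.commute)
qed

lemma orthonormal_norm:
  fixes v :: "'i::finite \<Rightarrow> 'a::euclidean_space"
  assumes "orthonormal_basis v"
  shows "norm x = sqrt (\<Sum>i\<in>UNIV. (x \<bullet> v i)\<^sup>2)"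
  by (simp add: norm_eq_sqrt_inner orthonormal_inner[OF assms, of x x] power2_eq_square)

lemma orthonormal_coordinate:
  fixes v :: "'i::finite \<Rightarrow> 'a::euclidean_space"
  assumes "orthonormal_basis v"
  shows "(\<Sum>i\<in>UNIV. c i *\<^sub>R v i) \<bullet> v j = c j"
proof -
  have "(\<Sum>i\<in>UNIV. c i *\<^sub>R v i) \<bullet> v j = (\<Sum>i\<in>UNIV. if i = j then c i else 0)"
    using assms by (intro trans[OF inner_sum_left] sum.cong) (auto simp: orthonormal_basis_def)
  then show ?thesis
    by simp
qed

text \<open>A point of the centred box with side lengths \<open>b i\<close> is at most half a
  diagonal away from the centre. This is the source of the factor 1/2 in the length bound.\<close>

lemma orthonormal_norm_le:
  fixes v :: "'i::finite \<Rightarrow> 'a::euclidean_space"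
  assumes "orthonormal_basis v" and b: "\<And>i. \<bar>x \<bullet> v i\<bar> \<le> b i / 2"
  shows "norm x \<le> sqrt (\<Sum>i\<in>UNIV. (b i)\<^sup>2) / 2"
proof -
  have "(x \<bullet> v i)\<^sup>2 \<le> (b i)\<^sup>2 / 4" for i
    using power_mono[OF b[of i], of 2] by (simp add: power_divide)
  then have "(\<Sum>i\<in>UNIV. (x \<bullet> v i)\<^sup>2) \<le> (\<Sum>i\<in>UNIV. (b i)\<^sup>2) / 4"
    by (auto simp: sum_divide_distrib intro!: sum_mono)
  then have "norm x \<le> sqrt ((\<Sum>i\<in>UNIV. (b i)\<^sup>2) / 4)"
    by (simp add: orthonormal_norm[OF assms(1)])
  then show ?thesis
    by (simp add: real_sqrt_divide)
qed

section \<open>Variation, length and valency estimates for the finite net\<close>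

context critical_net
begin

text \<open>Interior vertices have positive valency, so each is an endpoint of one of the finitely
  many edges.\<close>

lemma finite_interior_vertices: "finite (interior_vertices X E)"
proof (rule finite_subset)
  show "interior_vertices X E \<subseteq> \<Union>E"
    by (meson UnionI edge_of_vertex subsetI)
  show "finite (\<Union>E)"
    using finite_edges by (auto elim: edgeE)
qed

lemma finite_interior_edges: "finite (interior_edges X E)"
  using finite_edges interior_edges_subset finite_subset by blast

text \<open>By criticality the interior edges balance the edges at leaves. On the latter the field
  vanishes at a leaf, so by Cauchy-Schwarz each contributes at most the norm of the field at its
  other endpoint, and there are at most as many such edges as leaves.\<close>

lemma interior_variation_le:
  fixes g :: "'a \<Rightarrow> 'a"
  assumes M: "\<And>x. x \<in> interior_vertices X E \<Longrightarrow> norm (g x) \<le> M" and "0 \<le> M"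
  shows "(\<Sum>e\<in>interior_edges X E. variation_term g e) \<le> M * card (leaves X E)"
proof -
  let ?I = "interior_edges X E"
  define d where "d = (\<lambda>x. if x \<in> leaves X E then 0 else g x)"
  have "(\<Sum>\<^sub>\<infinity>e\<in>E. variation_term d e) = 0"
  proof -
    \<comment> \<open>On a finite, hence closed, set every function is continuous, so
      \<open>g\<close> restricted to the interior vertices extends to a continuous field.\<close>
    have "continuous_on (interior_vertices X E) g"
      by (simp add: continuous_on_finite finite_interior_vertices)
    then obtain h where h: "continuous_on UNIV h" "\<And>x. x \<in> interior_vertices X E \<Longrightarrow> h x = g x"
      using Dugundji[of "UNIV :: 'a set" UNIV "interior_vertices X E" g]
        finite_interior_vertices by (auto simp: finite_imp_closed)
    have "variation_term (\<lambda>x. if x \<in> leaves X E then 0 else h x) e = variation_term d e"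
      if "e \<in> E" for e
    proof -
      obtain x y where xy: "x \<in> X" "y \<in> X" "e = {x, y}"
        using edgeE[OF \<open>e \<in> E\<close>] by blast
      then show ?thesis
        using h(2) by (auto simp: variation_term_eq d_def interior_vertices_def)
    qed
    then show ?thesis
      using critical_cutoff(2)[OF h(1)] by (simp cong: infsum_cong)
  qed
  then have "0 = (\<Sum>e\<in>E. variation_term d e)"
    using finite_edges by simp
  also have "\<dots> = (\<Sum>e\<in>E - ?I. variation_term d e) + (\<Sum>e\<in>?I. variation_term d e)"
    by (rule sum.subset_diff[OF interior_edges_subset finite_edges])
  also have "(\<Sum>e\<in>?I. variation_term d e) = (\<Sum>e\<in>?I. variation_term g e)"
    by (intro sum.cong)
      (auto elim!: interior_edgeE simp: variation_term_eq d_def interior_vertices_def)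
  finally have "(\<Sum>e\<in>?I. variation_term g e) = (\<Sum>e\<in>E - ?I. - variation_term d e)"
    by (simp add: sum_negf)
  also have "\<dots> \<le> of_nat (card (E - ?I)) * M"
  proof (rule sum_bounded_above)
    fix e assume e: "e \<in> E - ?I"
    then obtain b where b: "b \<in> leaves X E" "b \<in> e"
      by (rule leaf_edge_contains_leaf)
    with e obtain x where x: "x \<in> X" "x \<noteq> b" "e = {x, b}"
      by (metis DiffD1 edgeE insertE insert_commute singletonD)
    \<comment> \<open>The other endpoint may be a leaf as well; then \<open>d x = 0\<close> and
      \<open>0 \<le> M\<close> is what is needed.\<close>
    have "norm (d x) \<le> M"
      using M[of x] \<open>0 \<le> M\<close> x by (auto simp: d_def interior_vertices_def)
    have "- variation_term d e = ((b - x) /\<^sub>R norm (x - b)) \<bullet> d x"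
      using b(1) x by (simp add: variation_term_eq d_def inner_diff_left algebra_simps)
    also have "\<dots> \<le> norm ((b - x) /\<^sub>R norm (x - b)) * norm (d x)"
      by (rule norm_cauchy_schwarz)
    also have "\<dots> = norm (d x)"
      using x by (simp add: norm_minus_commute)
    finally show "- variation_term d e \<le> M"
      using \<open>norm (d x) \<le> M\<close> by simp
  qed
  also have "\<dots> \<le> of_nat (card (leaves X E)) * M"
    using card_leaf_edges_le \<open>0 \<le> M\<close> by (intro mult_right_mono) auto
  finally show ?thesis
    by (simp add: mult.commute)
qed

theorem total_length_le:
  fixes v :: "'i::finite \<Rightarrow> 'a"
  assumes "orthonormal_basis v"
  shows "total_length X E \<le>
    ennreal (sqrt (\<Sum>i\<in>UNIV. (proj_length X E (v i))\<^sup>2) / 2 * real (card (leaves X E)))"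
proof -
  let ?V = "interior_vertices X E"
  define M where "M = sqrt (\<Sum>i\<in>UNIV. (proj_length X E (v i))\<^sup>2) / 2"
  \<comment> \<open>The midpoint of the projection onto \<open>w\<close>. Thus \<open>c\<close> is
    the centre of the bounding box and \<open>M\<close> half its diagonal.\<close>
  define mid where "mid w = ((SUP x\<in>?V. x \<bullet> w) + (INF x\<in>?V. x \<bullet> w)) / 2" for w :: 'a
  define c where "c = (\<Sum>i\<in>UNIV. mid (v i) *\<^sub>R v i)"
  have "norm (x - c) \<le> M" if "x \<in> ?V" for x
    unfolding M_def
  proof (rule orthonormal_norm_le[OF assms])
    fix i
    have "x \<bullet> v i \<le> (SUP x\<in>?V. x \<bullet> v i)" "(INF x\<in>?V. x \<bullet> v i) \<le> x \<bullet> v i"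
      using that finite_interior_vertices by (auto intro!: cSUP_upper cINF_lower)
    moreover have "(x - c) \<bullet> v i = x \<bullet> v i - mid (v i)"
      by (simp add: c_def inner_diff_left orthonormal_coordinate[OF assms])
    ultimately show "\<bar>(x - c) \<bullet> v i\<bar> \<le> proj_length X E (v i) / 2"
      using that by (auto simp: mid_def proj_length_def abs_le_iff field_simps)
  qed
  then have *: "(\<Sum>e\<in>interior_edges X E. variation_term (\<lambda>x. x - c) e) \<le> M * card (leaves X E)"
    by (intro interior_variation_le) (auto simp: M_def sum_nonneg)
  \<comment> \<open>The centre cancels in differences, so the variation on an edge is its unit
    vector paired with the edge vector, that is, the edge length.\<close>
  have eq: "on_edge dist e = variation_term (\<lambda>x. x - c) e" if "e \<in> interior_edges X E" for e
    using that
  proof (rule interior_edgeE)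
    fix x y assume "e = {x, y}"
    moreover have "(x - y) \<bullet> (x - y) / norm (x - y) = norm (x - y)"
      by (simp add: dot_square_norm power2_eq_square)
    ultimately show ?thesis
      by (simp add: variation_term_eq on_edge_eq[OF dist_commute] dist_norm divide_inverse_commute)
  qed
  have nonneg: "0 \<le> on_edge dist e" if "e \<in> interior_edges X E" for e
    using that by (elim interior_edgeE) (simp add: on_edge_eq[OF dist_commute])
  have "total_length X E = (\<Sum>e\<in>interior_edges X E. ennreal (on_edge dist e))"
    by (simp add: total_length_def finite_interior_edges)
  also have "\<dots> = ennreal (\<Sum>e\<in>interior_edges X E. on_edge dist e)"
    using nonneg by simp
  also have "\<dots> \<le> ennreal (M * card (leaves X E))"
    using * eq by (intro ennreal_leI) simp
  finally show ?thesis
    by (simp add: M_def)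
qed

text \<open>Double counting of incidences: an interior edge has two interior endpoints, and any
  other edge has at most one because it contains a leaf.\<close>

lemma sum_valency_le:
  "(\<Sum>x\<in>interior_vertices X E. valency E x) \<le> 2 * card (interior_edges X E) + card (leaves X E)"
proof -
  let ?V = "interior_vertices X E" and ?I = "interior_edges X E"
  have "(\<Sum>x\<in>?V. valency E x) = (\<Sum>x\<in>?V. \<Sum>e\<in>E. if x \<in> e then 1 else 0)"
    by (simp add: valency_eq_card_incident finite_edges sum.If_cases Int_def)
  also have "\<dots> = (\<Sum>e\<in>E. \<Sum>x\<in>?V. if x \<in> e then 1 else 0)"
    by (rule sum.swap)
  also have "\<dots> = (\<Sum>e\<in>E. card (?V \<inter> e))"
    by (simp add: finite_interior_vertices sum.If_cases Int_def)
  also have "\<dots> = (\<Sum>e\<in>E - ?I. card (?V \<inter> e)) + (\<Sum>e\<in>?I. card (?V \<inter> e))"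
    by (rule sum.subset_diff[OF interior_edges_subset finite_edges])
  also have "\<dots> \<le> of_nat (card (E - ?I)) * 1 + of_nat (card ?I) * 2"
  proof (intro add_mono sum_bounded_above)
    fix e assume e: "e \<in> E - ?I"
    then obtain b where b: "b \<in> leaves X E" "b \<in> e"
      by (rule leaf_edge_contains_leaf)
    with e obtain x where "e = {x, b}"
      by (metis DiffD1 edgeE insertE insert_commute singletonD)
    then have "?V \<inter> e \<subseteq> {x}"
      using b by (auto simp: interior_vertices_def)
    then show "card (?V \<inter> e) \<le> 1"
      using card_mono[of "{x}"] by simp
  next
    fix e assume "e \<in> ?I"
    then obtain x y where "e = {x, y}"
      by (rule interior_edgeE)
    then have "?V \<inter> e \<subseteq> {x, y}"
      by auto
    then have "card (?V \<inter> e) \<le> card {x, y}"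
      by (intro card_mono) auto
    also have "\<dots> \<le> 2"
      by (simp add: card_insert_if)
    finally show "card (?V \<inter> e) \<le> 2" .
  qed
  finally show ?thesis
    using card_leaf_edges_le by simp
qed

lemma card_interior_edges_le:
  fixes v :: "'i::finite \<Rightarrow> 'a"
  assumes v: "orthonormal_basis v" and D: "\<And>i. path_depth X E (v i) = enat (D i)"
  shows "real (card (interior_edges X E)) \<le>
    sqrt (\<Sum>i\<in>UNIV. (real (D i))\<^sup>2) / 2 * real (card (leaves X E))"
proof -
  \<comment> \<open>Heights lie between 0 and \<open>D i\<close>; centring this range bounds the
    coordinates by \<open>D i / 2\<close>.\<close>
  define c where "c x i = real (height (v i) x) - real (D i) / 2" for x i
  define g where "g x = (\<Sum>i\<in>UNIV. c x i *\<^sub>R v i)" for x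
  have gv: "g x \<bullet> v i = c x i" for x i
    unfolding g_def by (rule orthonormal_coordinate[OF v])
  have "1 \<le> variation_term g e" if "e \<in> interior_edges X E" for e
    using that
  proof (rule interior_edgeE)
    fix x y assume "e = {x, y}" "x \<noteq> y"
    define u where "u = (x - y) /\<^sub>R norm (x - y)"
    have "norm u = 1"
      using \<open>x \<noteq> y\<close> by (simp add: u_def)
    \<comment> \<open>By Parseval the squares sum to 1, and each is dominated by the matching
      coordinate's contribution to the variation.\<close>
    then have "1 = (\<Sum>i\<in>UNIV. (u \<bullet> v i)\<^sup>2)"
      using orthonormal_norm[OF v, of u] by simp
    also have "\<dots> \<le> (\<Sum>i\<in>UNIV. (u \<bullet> v i) * ((g x - g y) \<bullet> v i))"
    proof (rule sum_mono)
      fix i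
      have "norm (v i) = 1"
        using v by (simp add: orthonormal_basis_def norm_eq_sqrt_inner)
      then show "(u \<bullet> v i)\<^sup>2 \<le> (u \<bullet> v i) * ((g x - g y) \<bullet> v i)"
        using height_variation_ge[OF D, of x y i] that \<open>e = {x, y}\<close>
        by (simp add: u_def inner_diff_left gv c_def)
    qed
    also have "\<dots> = u \<bullet> (g x - g y)"
      by (rule orthonormal_inner[OF v, symmetric])
    also have "\<dots> = variation_term g e"
      by (simp add: \<open>e = {x, y}\<close> variation_term_eq u_def)
    finally show ?thesis .
  qed
  then have "real (card (interior_edges X E)) \<le> (\<Sum>e\<in>interior_edges X E. variation_term g e)"
    using sum_bounded_below[of "interior_edges X E" 1 "variation_term g"] by simp
  also have "\<dots> \<le> sqrt (\<Sum>i\<in>UNIV. (real (D i))\<^sup>2) / 2 * card (leaves X E)"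
  proof (rule interior_variation_le)
    fix x assume x: "x \<in> interior_vertices X E"
    show "norm (g x) \<le> sqrt (\<Sum>i\<in>UNIV. (real (D i))\<^sup>2) / 2"
    proof (rule orthonormal_norm_le[OF v])
      fix i
      show "\<bar>g x \<bullet> v i\<bar> \<le> real (D i) / 2"
        using height_le_depth[OF D x, of i] by (auto simp: gv c_def abs_le_iff field_simps)
    qed
  qed (simp add: sum_nonneg)
  finally show ?thesis .
qed

theorem interior_valency_sum_le:
  fixes v :: "'i::finite \<Rightarrow> 'a"
  assumes "orthonormal_basis v"
  shows "interior_valency_sum X E \<le>
      2 * of_nat (card (leaves X E)) +
      ennreal_sqrt (\<Sum>i\<in>UNIV. (ennreal_of_enat (path_depth X E (v i)))\<^sup>2) *
        of_nat (card (leaves X E))"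
proof (cases "\<exists>i. path_depth X E (v i) = \<infinity>")
  case True
  then obtain i where "path_depth X E (v i) = \<infinity>" ..
  then have "(ennreal_of_enat (path_depth X E (v i)))\<^sup>2 = top"
    by (simp add: power2_eq_square ennreal_mult_eq_top_iff)
  then have "(\<Sum>i\<in>UNIV. (ennreal_of_enat (path_depth X E (v i)))\<^sup>2) = top"
    by (simp add: sum.remove[of UNIV i])
  \<comment> \<open>In \<open>ennreal\<close> the product of \<open>top\<close> and 0 is 0; since
    leaves exist, the right-hand side is indeed \<open>top\<close>.\<close>
  moreover have "(of_nat (card (leaves X E)) :: ennreal) \<noteq> 0"
    using two_leaves by auto
  ultimately show ?thesis
    by (simp add: ennreal_sqrt_def ennreal_top_mult)
next
  case False
  then have "\<forall>i. \<exists>n. path_depth X E (v i) = enat n"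
    by auto
  then obtain D where D: "\<And>i. path_depth X E (v i) = enat (D i)"
    by metis
  define R where "R = sqrt (\<Sum>i\<in>UNIV. (real (D i))\<^sup>2)"
  have "R \<ge> 0"
    by (simp add: R_def sum_nonneg)
  have "(\<Sum>i\<in>UNIV. (ennreal_of_enat (path_depth X E (v i)))\<^sup>2) =
      (\<Sum>i\<in>UNIV. ennreal ((real (D i))\<^sup>2))"
    by (simp add: D ennreal_power[symmetric] ennreal_of_nat_eq_real_of_nat)
  also have "\<dots> = ennreal (\<Sum>i\<in>UNIV. (real (D i))\<^sup>2)"
    by simp
  finally have R: "ennreal_sqrt (\<Sum>i\<in>UNIV. (ennreal_of_enat (path_depth X E (v i)))\<^sup>2) = ennreal R"
    by (simp add: ennreal_sqrt_def R_def sum_nonneg)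
  have "real (\<Sum>x\<in>interior_vertices X E. valency E x) \<le>
      real (2 * card (interior_edges X E) + card (leaves X E))"
    using sum_valency_le by (simp only: of_nat_le_iff)
  \<comment> \<open>Twice the number of interior edges is at most \<open>R\<close> times the number
    of leaves. The leaf edges cost one more copy of the number of leaves, so the coefficient 2
    leaves slack.\<close>
  also have "\<dots> \<le> 2 * card (leaves X E) + R * card (leaves X E)"
    using card_interior_edges_le[OF assms D] by (simp add: R_def)
  finally have *: "ennreal (real (\<Sum>x\<in>interior_vertices X E. valency E x)) \<le>
      ennreal (2 * card (leaves X E) + R * card (leaves X E))"
    by (rule ennreal_leI)
  have "interior_valency_sum X E = ennreal (real (\<Sum>x\<in>interior_vertices X E. valency E x))"
    by (simp add: interior_valency_sum_def finite_interior_vertices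
      ennreal_of_nat_eq_real_of_nat[symmetric] del: of_nat_sum) simp
  also note *
  also have "ennreal (2 * card (leaves X E) + R * card (leaves X E)) =
      2 * of_nat (card (leaves X E)) + ennreal R * of_nat (card (leaves X E))"
    using \<open>R \<ge> 0\<close> by (simp add: ennreal_plus ennreal_mult ennreal_of_nat_eq_real_of_nat)
  finally show ?thesis
    by (simp add: R)
qed

end

theorem theoremB:
  fixes X :: "(real ^ 'k) set" and E :: "(real ^ 'k) set set"
    and v :: "'k::finite \<Rightarrow> real ^ 'k"
  assumes "critical_net X E"
    and "orthonormal_basis v"
  shows "total_length X E \<le>
      ennreal (sqrt (\<Sum>i\<in>UNIV. (proj_length X E (v i))\<^sup>2) / 2 * real (card (leaves X E))) \<and>
    interior_valency_sum X E \<le>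
      2 * of_nat (card (leaves X E)) +
      ennreal_sqrt (\<Sum>i\<in>UNIV. (ennreal_of_enat (path_depth X E (v i)))\<^sup>2) *
        of_nat (card (leaves X E))"
  using critical_net.total_length_le[OF assms] critical_net.interior_valency_sum_le[OF assms]
  by blast

end
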